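(* Let $G$ be a connected graph with a set of cousins $C=\{\{v_1,v_2\},\{v_3,v_4\}\}$ such that $v_1,v_2$ are not adjacent, $v_3,v_4$ are not adjacent, and the subgraph of $G+v_1v_2$ induced by $\{v_1,v_2,v_3,v_4\}$ is isomorphic to the subgraph of $G+v_3v_4$ induced by $\{v_1,v_2,v_3,v_4\}$. If $G_1=G+v_1v_2$ and $G_2=G+v_3v_4$ are not isomorphic, then they are $\mathcal D^L$-cospectral.
   Context: All graphs are finite, simple, undirected; $G+xy$ denotes $G$ with edge $xy$ added. For a connected graph $G$ with vertices $w_1,\dots,w_n$, $d_G(u,v)$ is the length of a shortest $u,v$-path, $t_G(v)=\sum_w d_G(v,w)$, $\mathcal D(G)$ is the matrix with $(i,j)$-entry $d_G(w_i,w_j)$, and the distance Laplacian is $\mathcal D^L(G)=\operatorname{diag}(t_G(w_1),\dots,t_G(w_n))-\mathcal D(G)$. Nonisomorphic graphs are $\mathcal D^L$-cospectral if their distance Laplacian matrices have the same spectrum. Let $G$ be a connected graph of order at least five with distinct vertices $v_1,v_2,v_3,v_4$, $C=\{\{v_1,v_2\},\{v_3,v_4\}\}$ and $U(C)=V(G)\setminus\{v_1,v_2,v_3,v_4\}$; $C$ is a set of cousins in $G$ if (1) for all $u\in U(C)$, $d_G(u,v_1)=d_G(u,v_2)$ and $d_G(u,v_3)=d_G(u,v_4)$; and (2) $\sum_{u\in U(C)}d_G(u,v_1)=\sum_{u\in U(C)}d_G(u,v_3)$. *)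

theory Defs
  imports
    "Graph_Theory.Graph_Theory"
    "Jordan_Normal_Form.Char_Poly"
    Complex_Main
begin

text \<open>
  Finite simple undirected graphs are the \<^locale>\<open>pair_graph\<close>s of the AFP: a finite vertex set
  and a symmetric irreflexive set of ordered pairs, an undirected edge being a pair together
  with its reverse.
\<close>

definition add_edge :: "'a pair_pre_digraph \<Rightarrow> 'a \<Rightarrow> 'a \<Rightarrow> 'a pair_pre_digraph" where
  "add_edge G x y = \<lparr>pverts = pverts G, parcs = parcs G \<union> {(x, y), (y, x)}\<rparr>"

text \<open>
  The value of \<open>gdist\<close> is meaningful only if some \<open>u\<close>,\<open>v\<close>-path exists, in particular for any two
  vertices of a connected graph.
\<close>

definition gdist :: "'a pair_pre_digraph \<Rightarrow> 'a \<Rightarrow> 'a \<Rightarrow> nat" where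
  "gdist G u v = (LEAST k. \<exists>p. pre_digraph.apath (with_proj G) u p v \<and> length p = k)"

definition transmission :: "'a pair_pre_digraph \<Rightarrow> 'a \<Rightarrow> nat" where
  "transmission G v = (\<Sum>w\<in>pverts G. gdist G v w)"

definition vertex_enum :: "'a pair_pre_digraph \<Rightarrow> 'a list \<Rightarrow> bool" where
  "vertex_enum G ws \<longleftrightarrow> distinct ws \<and> set ws = pverts G"

definition distance_mat :: "'a pair_pre_digraph \<Rightarrow> 'a list \<Rightarrow> real mat" where
  "distance_mat G ws =
     mat (length ws) (length ws) (\<lambda>(i, j). real (gdist G (ws ! i) (ws ! j)))"

definition distance_laplacian :: "'a pair_pre_digraph \<Rightarrow> 'a list \<Rightarrow> real mat" where
  "distance_laplacian G ws =
     mat_diag (length ws) (\<lambda>i. real (transmission G (ws ! i))) - distance_mat G ws"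

text \<open>
  The spectrum is the multiset of all complex eigenvalues, counted with algebraic multiplicity.
  (The constant \<open>spectrum\<close> of the AFP is only the set of eigenvalues.)
\<close>

definition mat_spectrum :: "real mat \<Rightarrow> complex multiset" where
  "mat_spectrum A = proots (char_poly (map_mat complex_of_real A))"

text \<open>
  The spectrum does not depend on the enumeration of the vertices, so quantifying over all
  enumerations is the same as fixing one for each graph.
\<close>

definition DL_cospectral :: "'a pair_pre_digraph \<Rightarrow> 'b pair_pre_digraph \<Rightarrow> bool" where
  "DL_cospectral G H \<longleftrightarrow>
     \<not> digraph_iso (with_proj G) (with_proj H) \<and>
     (\<forall>ws us. vertex_enum G ws \<longrightarrow> vertex_enum H us \<longrightarrow>
        mat_spectrum (distance_laplacian G ws) = mat_spectrum (distance_laplacian H us))"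

text \<open>
  \<open>cousins G v1 v2 v3 v4\<close> says that \<open>{{v1, v2}, {v3, v4}}\<close> is a set of cousins in \<open>G\<close>; it is
  invariant under exchanging \<open>v1\<close> and \<open>v2\<close>, \<open>v3\<close> and \<open>v4\<close>, and the two pairs.
\<close>

definition cousins :: "'a pair_pre_digraph \<Rightarrow> 'a \<Rightarrow> 'a \<Rightarrow> 'a \<Rightarrow> 'a \<Rightarrow> bool" where
  "cousins G v1 v2 v3 v4 \<longleftrightarrow>
     pair_graph G \<and> connected (with_proj G) \<and> 5 \<le> card (pverts G) \<and>
     {v1, v2, v3, v4} \<subseteq> pverts G \<and> distinct [v1, v2, v3, v4] \<and>
     (let U = pverts G - {v1, v2, v3, v4} in
        (\<forall>u\<in>U. gdist G u v1 = gdist G u v2 \<and> gdist G u v3 = gdist G u v4) \<and>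
        (\<Sum>u\<in>U. gdist G u v1) = (\<Sum>u\<in>U. gdist G u v3))"

end

theory Submission
  imports Defs
begin

text \<open>
  Since \<open>v1\<close>, \<open>v2\<close> are equidistant from every outside vertex, as are \<open>v3\<close>, \<open>v4\<close>, adding either edge
  changes distances only inside \<open>W = {v1, v2, v3, v4}\<close>. The equality of the distance sums forces both
  pairs to have common outside neighbours, so both are at distance 2 in \<open>G\<close>, and the
  isomorphism of the induced subgraphs forces, up to exchanging \<open>v3\<close> and \<open>v4\<close>, that the distances
  \<open>v1\<close>--\<open>v4\<close> and \<open>v2\<close>--\<open>v3\<close> agree in \<open>G\<close>. Hence the distances of \<open>G2\<close> on \<open>W\<close> are those of \<open>G1\<close>
  transported along the permutation \<open>\<sigma> = (v1 v3)(v2 v4)\<close>. With \<open>J\<close> the all-ones matrix on \<open>W\<close> and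
  \<open>P\<close> the matrix of \<open>\<sigma>\<close>, the matrix \<open>J/2 - P\<close> is a symmetric involution that fixes \<open>(1,1,0,0)\<close> and
  \<open>(0,0,1,1)\<close>, and conjugation by it acts on Laplacian matrices on \<open>W\<close> as conjugation by \<open>P\<close>.
  Extended by the identity outside \<open>W\<close>, it conjugates one distance Laplacian into the other.
\<close>

section \<open>Graph distances\<close>

context pair_wf_digraph
begin

text \<open>\<open>gdist\<close> minimises over paths only. Cutting cycles out of a walk never
  lengthens it, so every walk gives an upper bound too.\<close>

lemma gdist_le_length:
  assumes "awalk u p v"
  shows "gdist G u v \<le> length p"
proof -
  have "length (awalk_to_apath p) \<le> length p"
    using assms
  proof (induct rule: awalk_to_apath_induct)
    case (path p)
    then show ?case by (auto simp: awalk_to_apath.simps)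
  next
    case (decomp p q r s)
    then have "p = q @ r @ s" by (auto elim: awalk_cyc_decompE)
    with decomp show ?case using step_awalk_to_apath[of u p v q r s] by simp
  qed
  moreover have "gdist G u v \<le> length (awalk_to_apath p)"
    unfolding gdist_def by (rule Least_le) (use apath_awalk_to_apath[OF assms] in blast)
  ultimately show ?thesis by simp
qed

lemma gdist_awalkE:
  assumes "awalk u p v"
  obtains q where "awalk u q v" "length q = gdist G u v"
proof -
  have "\<exists>k. \<exists>q. apath u q v \<and> length q = k"
    using apath_awalk_to_apath[OF assms] by blast
  then have "\<exists>q. apath u q v \<and> length q = gdist G u v"
    unfolding gdist_def by (rule LeastI_ex)
  then show ?thesis using that by (auto simp: apath_def)
qed

text \<open>A local test for being the distance function: \<open>f_le\<close> bounds the length of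
  every walk from below, and \<open>f_step\<close> allows a greedy descent that builds a walk
  attaining the bound. It spares any surgery on paths when an edge is added.\<close>

lemma gdist_eqI:
  assumes f_refl: "\<And>z. z \<in> pverts G \<Longrightarrow> f z z = 0"
    and f_le: "\<And>x y z. (x, y) \<in> parcs G \<Longrightarrow> z \<in> pverts G \<Longrightarrow> f x z \<le> Suc (f y z)"
    and f_step: "\<And>x z. x \<in> pverts G \<Longrightarrow> z \<in> pverts G \<Longrightarrow> x \<noteq> z \<Longrightarrow>
       \<exists>y. (x, y) \<in> parcs G \<and> f x z = Suc (f y z)"
    and "u \<in> pverts G" "v \<in> pverts G"
  shows "gdist G u v = f u v"
proof -
  have "\<exists>p. awalk u p v \<and> length p = f u v"
    using \<open>u \<in> pverts G\<close>
  proof (induction "f u v" arbitrary: u)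
    case 0
    then have "u = v" using f_step[of u v] \<open>v \<in> pverts G\<close> by force
    with 0 show ?case by (intro exI[of _ "[]"]) (simp add: awalk_Nil_iff)
  next
    case (Suc n)
    then have "u \<noteq> v" using f_refl[of v] \<open>v \<in> pverts G\<close> by force
    then obtain y where y: "(u, y) \<in> parcs G" "f u v = Suc (f y v)"
      using f_step \<open>v \<in> pverts G\<close> Suc.prems by blast
    then obtain p where "awalk y p v" "length p = f y v"
      using Suc.hyps in_arcsD2 by force
    with y show ?case by (intro exI[of _ "(u, y) # p"]) (simp add: awalk_Cons_iff)
  qed
  then obtain p where p: "awalk u p v" "length p = f u v" by blast
  have lower: "f u v \<le> length q" if "awalk u q v" for q
    using that
  proof (induction q arbitrary: u)
    case Nil
    then show ?case by (auto simp: awalk_Nil_iff f_refl)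
  next
    case (Cons e es)
    obtain x y where e: "e = (x, y)" by (cases e)
    with Cons have "x = u" "(u, y) \<in> parcs G" "f y v \<le> length es"
      by (auto simp: awalk_Cons_iff)
    then show ?case using f_le[of u y v] \<open>v \<in> pverts G\<close> by auto
  qed
  from gdist_awalkE[OF p(1)] lower have "f u v \<le> gdist G u v" by metis
  with gdist_le_length[OF p(1)] p(2) show ?thesis by simp
qed

lemma gdist_refl: "u \<in> pverts G \<Longrightarrow> gdist G u u = 0"
  using gdist_le_length[of u "[]" u] by (simp add: awalk_Nil_iff)

end

section \<open>The metric of a connected graph\<close>

locale connected_pair_graph = pair_graph +
  assumes connected: "connected (with_proj G)"
begin

abbreviation d where "d \<equiv> gdist G"

lemma shortest_awalkE:
  assumes "u \<in> pverts G" "v \<in> pverts G"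
  obtains p where "awalk u p v" "length p = d u v"
proof -
  have "u \<rightarrow>\<^sup>*\<^bsub>with_proj G\<^esub> v"
    using symmetric_connected_imp_strongly_connected[OF _ connected] pair_sym_arcs assms
    by (auto simp: strongly_connected_def)
  then show ?thesis using that gdist_awalkE unfolding reachable_awalk by metis
qed

lemma gdist_triangle:
  assumes "u \<in> pverts G" "v \<in> pverts G" "w \<in> pverts G"
  shows "d u w \<le> d u v + d v w"
proof -
  obtain p where "awalk u p v" "length p = d u v" using shortest_awalkE assms by blast
  moreover obtain q where "awalk v q w" "length q = d v w" using shortest_awalkE assms by blast
  ultimately show ?thesis using gdist_le_length[of u "p @ q" w] by simp
qed

lemma gdist_sym:
  assumes "u \<in> pverts G" "v \<in> pverts G"
  shows "d u v = d v u"
proof -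
  have len: "length (rev_path p) = length p" for p :: "('a \<times> 'a) list"
    by (induction p) auto
  have "d y x \<le> d x y" if xy: "x \<in> pverts G" "y \<in> pverts G" for x y
  proof -
    obtain p where p: "awalk x p y" "length p = d x y" using shortest_awalkE xy by blast
    have "awalk y (rev_path p) x" using p by simp
    from gdist_le_length[OF this] show ?thesis by (simp add: len p)
  qed
  then show ?thesis using assms by (metis le_antisym)
qed

lemma gdist_arc_le: "(u, v) \<in> parcs G \<Longrightarrow> d u v \<le> 1"
  using gdist_le_length[of u "[(u, v)]" v] in_arcsD2 by (auto simp: awalk_Cons_iff awalk_Nil_iff)

lemma gdist_step:
  assumes "u \<in> pverts G" "v \<in> pverts G" "u \<noteq> v"
  obtains x where "(u, x) \<in> parcs G" "x \<in> pverts G" "d u v = Suc (d x v)"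
proof -
  obtain p where p: "awalk u p v" "length p = d u v" using shortest_awalkE assms by blast
  with assms obtain e es where "p = e # es" by (cases p) (auto simp: awalk_Nil_iff)
  moreover obtain y x where "e = (y, x)" by (cases e)
  ultimately have x: "(u, x) \<in> parcs G" "awalk x es v" "d u v = Suc (length es)"
    using p by (auto simp: awalk_Cons_iff)
  then have "x \<in> pverts G" using in_arcsD2 by blast
  moreover have "d x v \<le> length es" using gdist_le_length x by blast
  moreover have "d u v \<le> d u x + d x v" using gdist_triangle assms \<open>x \<in> pverts G\<close> by blast
  ultimately show ?thesis using that[of x] x gdist_arc_le[of u x] by simp
qed

lemma gdist_eq_0_iff:
  assumes "u \<in> pverts G" "v \<in> pverts G"
  shows "d u v = 0 \<longleftrightarrow> u = v"
  using gdist_refl assms by (auto elim: gdist_step[of u v])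

lemma gdist_eq_1_iff:
  assumes "u \<in> pverts G" "v \<in> pverts G"
  shows "d u v = 1 \<longleftrightarrow> (u, v) \<in> parcs G"
proof
  assume "d u v = 1"
  then have "u \<noteq> v" using gdist_refl assms by auto
  from gdist_step[OF assms this] obtain x where "(u, x) \<in> parcs G" "x \<in> pverts G" "d u v = Suc (d x v)" .
  then show "(u, v) \<in> parcs G" using \<open>d u v = 1\<close> gdist_eq_0_iff assms by simp
next
  assume uv: "(u, v) \<in> parcs G"
  then have "u \<noteq> v" using no_loops' by auto
  then have "d u v \<noteq> 0" using gdist_eq_0_iff assms by simp
  then show "d u v = 1" using gdist_arc_le[OF uv] by linarith
qed

text \<open>A shortest path uses the new edge at most once, in one of two directions. The proof
  checks that the right-hand side satisfies the local conditions of \<open>gdist_eqI\<close> in the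
  enlarged graph.\<close>

lemma gdist_add_edge:
  assumes ab: "a \<in> pverts G" "b \<in> pverts G" and uv: "u \<in> pverts G" "v \<in> pverts G"
  shows "gdist (add_edge G a b) u v =
    min (d u v) (min (d u a + 1 + d b v) (d u b + 1 + d a v))"
proof -
  let ?H = "add_edge G a b"
  let ?f = "\<lambda>u v. min (d u v) (min (d u a + 1 + d b v) (d u b + 1 + d a v))"
  have V: "pverts ?H = pverts G" and E: "parcs ?H = parcs G \<union> {(a, b), (b, a)}"
    by (simp_all add: add_edge_def)
  interpret H: pair_wf_digraph ?H
    using ab by unfold_locales (auto simp: add_edge_def dest: in_arcsD1 in_arcsD2)
  have le: "?f x z \<le> Suc (?f y z)" if "(x, y) \<in> parcs ?H" "z \<in> pverts ?H" for x y z
  proof (cases "(x, y) \<in> parcs G")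
    case True
    then have "x \<in> pverts G" "y \<in> pverts G" by (auto dest: in_arcsD1 in_arcsD2)
    then have "d x w \<le> Suc (d y w)" if "w \<in> pverts G" for w
      using gdist_triangle[of x y w] gdist_arc_le[OF True] that by simp
    from this[of z] this[of a] this[of b] show ?thesis using ab that V by auto
  next
    case False
    then have "x = a \<and> y = b \<or> x = b \<and> y = a" using that E by auto
    then show ?thesis using gdist_refl[of a] gdist_refl[of b] ab by auto
  qed
  have step: "\<exists>y. (x, y) \<in> parcs ?H \<and> ?f x z = Suc (?f y z)"
    if "x \<in> pverts ?H" "z \<in> pverts ?H" "x \<noteq> z" for x z
  proof -
    \<comment> \<open>It is enough to find a neighbour that is closer by at least one, since
      \<open>le\<close> supplies the reverse inequality.\<close>
    have "\<exists>y. (x, y) \<in> parcs ?H \<and> Suc (?f y z) \<le> ?f x z"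
    proof -
      have xz: "x \<in> pverts G" "z \<in> pverts G" using that V by auto
      \<comment> \<open>First step of a route that crosses the new edge from \<open>a'\<close> to
        \<open>b'\<close>: the new edge itself if \<open>x = a'\<close>, otherwise a step in
        \<open>G\<close> towards \<open>a'\<close>.\<close>
      have via: "\<exists>y. (x, y) \<in> parcs ?H \<and> Suc (?f y z) \<le> d x a' + 1 + d b' z"
        if ends: "a' = a \<and> b' = b \<or> a' = b \<and> b' = a" for a' b'
      proof (cases "x = a'")
        case True
        then show ?thesis using ends E by (intro exI[of _ b']) auto
      next
        case False
        then obtain y where "(x, y) \<in> parcs G" "d x a' = Suc (d y a')"
          using gdist_step[of x a'] xz ab ends by blast
        then show ?thesis using ends E by (intro exI[of _ y]) auto
      qed
      consider "?f x z = d x z" | "?f x z = d x a + 1 + d b z" | "?f x z = d x b + 1 + d a z"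
        by linarith
      then show ?thesis
      proof cases
        case 1
        obtain y where "(x, y) \<in> parcs G" "d x z = Suc (d y z)"
          using gdist_step[OF xz \<open>x \<noteq> z\<close>] by blast
        with 1 show ?thesis using E by (intro exI[of _ y]) auto
      next
        case 2
        then show ?thesis using via[of a b] by simp
      next
        case 3
        then show ?thesis using via[of b a] by simp
      qed
    qed
    then show ?thesis using le that by (meson le_antisym)
  qed
  show ?thesis
    by (rule H.gdist_eqI[where f = ?f]) (use le step uv V gdist_refl in auto)
qed

end

section \<open>Similarity of the distance Laplacians\<close>

lemma sum_nth_distinct:
  assumes "distinct xs"
  shows "(\<Sum>k<length xs. g (xs ! k)) = sum g (set xs)"
  using sum.reindex_bij_betw[OF bij_betw_nth[OF assms, of "{..<length xs}" "set xs"], of g] by simp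

text \<open>The hypotheses say that \<open>Q\<close> is orthogonal and intertwines \<open>K\<close>
  and \<open>L\<close>, without reference to an ordering. Indexing the rows of \<open>Q\<close> by
  \<open>ws\<close> and its columns by \<open>us\<close> absorbs the change of enumeration into the
  similarity; the inverse is the transpose \<open>P'\<close>.\<close>

lemma similar_mat_reindex:
  fixes K L Q :: "'a \<Rightarrow> 'a \<Rightarrow> 'b :: comm_ring_1"
  assumes ws: "distinct ws" "set ws = V" and us: "distinct us" "set us = V"
    and intertwine: "\<And>x z. x \<in> V \<Longrightarrow> z \<in> V \<Longrightarrow>
      (\<Sum>y\<in>V. K x y * Q y z) = (\<Sum>y\<in>V. Q x y * L y z)"
    and rows: "\<And>x z. x \<in> V \<Longrightarrow> z \<in> V \<Longrightarrow> (\<Sum>y\<in>V. Q x y * Q z y) = of_bool (x = z)"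
    and cols: "\<And>x z. x \<in> V \<Longrightarrow> z \<in> V \<Longrightarrow> (\<Sum>y\<in>V. Q y x * Q y z) = of_bool (x = z)"
  shows "similar_mat (mat (length ws) (length ws) (\<lambda>(i, j). K (ws ! i) (ws ! j)))
    (mat (length us) (length us) (\<lambda>(i, j). L (us ! i) (us ! j)))"
    (is "similar_mat ?A ?B")
proof -
  define n where "n = length ws"
  have n: "length ws = n" "length us = n"
    using ws us distinct_card[of ws] distinct_card[of us] by (simp_all add: n_def)
  have mem: "ws ! i \<in> V" "us ! i \<in> V" if "i < n" for i
    using that ws us n nth_mem[of i ws] nth_mem[of i us] by auto
  have sums: "(\<Sum>k = 0..<n. g (ws ! k)) = sum g V" "(\<Sum>k = 0..<n. g (us ! k)) = sum g V"
    for g :: "'a \<Rightarrow> 'b"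
    using sum_nth_distinct[OF ws(1), of g] sum_nth_distinct[OF us(1), of g] ws us n
    by (simp_all add: atLeast0LessThan)
  have inj: "ws ! i = ws ! j \<longleftrightarrow> i = j" "us ! i = us ! j \<longleftrightarrow> i = j" if "i < n" "j < n" for i j
    using that ws us n by (simp_all add: nth_eq_iff_index_eq)
  define P where "P = mat n n (\<lambda>(i, j). Q (ws ! i) (us ! j))"
  define P' where "P' = mat n n (\<lambda>(i, j). Q (ws ! j) (us ! i))"
  have carrier: "?A \<in> carrier_mat n n" "?B \<in> carrier_mat n n" "P \<in> carrier_mat n n" "P' \<in> carrier_mat n n"
    by (simp_all add: P_def P'_def n)
  have PP': "P * P' = 1\<^sub>m n"
  proof (rule eq_matI)
    fix i j assume "i < dim_row (1\<^sub>m n :: 'b mat)" "j < dim_col (1\<^sub>m n :: 'b mat)"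
    then show "(P * P') $$ (i, j) = 1\<^sub>m n $$ (i, j)"
      using sums(2)[of "\<lambda>y. Q (ws ! i) y * Q (ws ! j) y"]
      by (simp add: P_def P'_def scalar_prod_def rows mem inj)
  qed (simp_all add: P_def P'_def)
  have P'P: "P' * P = 1\<^sub>m n"
  proof (rule eq_matI)
    fix i j assume "i < dim_row (1\<^sub>m n :: 'b mat)" "j < dim_col (1\<^sub>m n :: 'b mat)"
    then show "(P' * P) $$ (i, j) = 1\<^sub>m n $$ (i, j)"
      using sums(1)[of "\<lambda>y. Q y (us ! i) * Q y (us ! j)"]
      by (simp add: P_def P'_def scalar_prod_def cols mem inj)
  qed (simp_all add: P_def P'_def)
  have AP: "?A * P = P * ?B"
  proof (rule eq_matI)
    fix i j assume "i < dim_row (P * ?B)" "j < dim_col (P * ?B)"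
    then show "(?A * P) $$ (i, j) = (P * ?B) $$ (i, j)"
      using sums(1)[of "\<lambda>y. K (ws ! i) y * Q y (us ! j)"]
        sums(2)[of "\<lambda>y. Q (ws ! i) y * L y (us ! j)"] intertwine[of "ws ! i" "us ! j"]
      by (simp add: P_def scalar_prod_def mem n)
  qed (simp_all add: P_def n)
  have "?A = ?A * (P * P')" by (simp only: PP' right_mult_one_mat[OF carrier(1)])
  also have "\<dots> = ?A * P * P'" by (rule assoc_mult_mat[symmetric, OF carrier(1,3,4)])
  also have "\<dots> = P * ?B * P'" by (simp add: AP)
  finally show ?thesis
    using carrier PP' P'P by (intro similar_matI[of _ _ P P' n]) auto
qed

text \<open>Indexed by vertices instead of positions, so that the algebra does not depend on an
  enumeration.\<close>

definition weighted_laplacian :: "'a set \<Rightarrow> ('a \<Rightarrow> 'a \<Rightarrow> real) \<Rightarrow> 'a \<Rightarrow> 'a \<Rightarrow> real" where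
  "weighted_laplacian V \<delta> x y = (if x = y then sum (\<delta> x) V else 0) - \<delta> x y"

lemma distance_laplacian_eq_weighted_laplacian:
  assumes "set ws = pverts G" "distinct ws"
  shows "distance_laplacian G ws =
    mat (length ws) (length ws) (\<lambda>(i, j). weighted_laplacian (pverts G) (\<lambda>x y. real (gdist G x y)) (ws ! i) (ws ! j))"
  using assms
  by (intro eq_matI)
    (auto simp: distance_laplacian_def mat_diag_def distance_mat_def weighted_laplacian_def transmission_def
      nth_eq_iff_index_eq)

lemma mat_spectrum_similar:
  assumes "similar_mat A B"
  shows "mat_spectrum A = mat_spectrum B"
proof -
  from similar_matD[OF assms] obtain n where "A \<in> carrier_mat n n" "B \<in> carrier_mat n n" by auto
  then show ?thesis
    using char_poly_similar[OF assms] by (simp add: mat_spectrum_def of_real_hom.char_poly_hom)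
qed

text \<open>A row of an outside vertex has the form (a,a,b,b) on the cousins, which the involution
  fixes. The block on the cousins is an ordinary Laplacian plus \<open>s\<close> times the identity;
  the Laplacian annihilates the all-ones vector, so only the permutation acts on it. The equations
  \<open>swap\<close> say that this permutation carries \<delta> to \<epsilon> on the
  cousins.\<close>

lemma similar_mat_weighted_laplacian_cousin_swap:
  fixes v1 v2 v3 v4 :: 'a and U :: "'a set" and \<delta> \<epsilon> :: "'a \<Rightarrow> 'a \<Rightarrow> real"
  defines "V \<equiv> {v1, v2, v3, v4} \<union> U"
  assumes "finite U" and dist: "distinct [v1, v2, v3, v4]"
    and notin: "v1 \<notin> U" "v2 \<notin> U" "v3 \<notin> U" "v4 \<notin> U"
    and sym: "\<And>x y. x \<in> V \<Longrightarrow> y \<in> V \<Longrightarrow> \<delta> x y = \<delta> y x" "\<And>x y. x \<in> V \<Longrightarrow> y \<in> V \<Longrightarrow> \<epsilon> x y = \<epsilon> y x"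
    and diag: "\<And>x. x \<in> V \<Longrightarrow> \<delta> x x = 0" "\<And>x. x \<in> V \<Longrightarrow> \<epsilon> x x = 0"
    and off: "\<And>u x. u \<in> U \<Longrightarrow> x \<in> V \<Longrightarrow> \<epsilon> u x = \<delta> u x"
    and cousin: "\<And>u. u \<in> U \<Longrightarrow> \<delta> u v2 = \<delta> u v1" "\<And>u. u \<in> U \<Longrightarrow> \<delta> u v4 = \<delta> u v3"
    and sums: "(\<Sum>u\<in>U. \<delta> u v1) = (\<Sum>u\<in>U. \<delta> u v3)"
    and swap: "\<epsilon> v1 v2 = \<delta> v3 v4" "\<epsilon> v3 v4 = \<delta> v1 v2" "\<epsilon> v1 v3 = \<delta> v1 v3"
      "\<epsilon> v2 v4 = \<delta> v2 v4" "\<epsilon> v1 v4 = \<delta> v2 v3" "\<epsilon> v2 v3 = \<delta> v1 v4"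
    and ws: "distinct ws" "set ws = V" and us: "distinct us" "set us = V"
  shows "similar_mat (mat (length ws) (length ws) (\<lambda>(i, j). weighted_laplacian V \<delta> (ws ! i) (ws ! j)))
    (mat (length us) (length us) (\<lambda>(i, j). weighted_laplacian V \<epsilon> (us ! i) (us ! j)))"
proof -
  have ne: "v1 \<noteq> v2" "v1 \<noteq> v3" "v1 \<noteq> v4" "v2 \<noteq> v3" "v2 \<noteq> v4" "v3 \<noteq> v4"
    "v2 \<noteq> v1" "v3 \<noteq> v1" "v4 \<noteq> v1" "v3 \<noteq> v2" "v4 \<noteq> v2" "v4 \<noteq> v3"
    using dist by auto
  have sumV: "sum g V = g v1 + g v2 + g v3 + g v4 + sum g U" for g :: "'a \<Rightarrow> real"
    using \<open>finite U\<close> notin ne by (simp add: V_def)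
  define W where "W = {v1, v2, v3, v4}"
  define P where "P = {(v1, v3), (v3, v1), (v2, v4), (v4, v2)}"
  define Q :: "'a \<Rightarrow> 'a \<Rightarrow> real" where
    "Q x y = (if x \<in> W \<and> y \<in> W then 1/2 - of_bool ((x, y) \<in> P) else of_bool (x = y))" for x y
  have "(x, y) \<in> P \<longleftrightarrow> (y, x) \<in> P" for x y by (auto simp: P_def)
  then have Q_sym: "Q x y = Q y x" for x y by (auto simp: Q_def)
  have UW: "u \<noteq> v1" "u \<noteq> v2" "u \<noteq> v3" "u \<noteq> v4" "v1 \<noteq> u" "v2 \<noteq> u" "v3 \<noteq> u" "v4 \<noteq> u" if "u \<in> U" for u
    using that notin by auto
  have QU: "Q u y = of_bool (u = y)" "Q y u = of_bool (y = u)" if "u \<in> U" for u y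
    using that notin by (auto simp: Q_def W_def)
  have QW: "Q v1 v1 = 1/2" "Q v1 v2 = 1/2" "Q v1 v3 = -1/2" "Q v1 v4 = 1/2"
     "Q v2 v1 = 1/2" "Q v2 v2 = 1/2" "Q v2 v3 = 1/2" "Q v2 v4 = -1/2"
     "Q v3 v1 = -1/2" "Q v3 v2 = 1/2" "Q v3 v3 = 1/2" "Q v3 v4 = 1/2"
     "Q v4 v1 = 1/2" "Q v4 v2 = -1/2" "Q v4 v3 = 1/2" "Q v4 v4 = 1/2"
    using ne by (simp_all add: Q_def W_def P_def)
  have left: "(\<Sum>y\<in>U. g y * Q y z) = (if z \<in> U then g z else 0)"
    and right: "(\<Sum>y\<in>U. Q z y * g y) = (if z \<in> U then g z else 0)" for g :: "'a \<Rightarrow> real" and z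
  proof -
    have "(\<Sum>y\<in>U. g y * Q y z) = (\<Sum>y\<in>U. if y = z then g y else 0)"
      "(\<Sum>y\<in>U. Q z y * g y) = (\<Sum>y\<in>U. if y = z then g y else 0)"
      by (intro sum.cong; simp add: QU)+
    then show "(\<Sum>y\<in>U. g y * Q y z) = (if z \<in> U then g z else 0)"
      "(\<Sum>y\<in>U. Q z y * g y) = (if z \<in> U then g z else 0)"
      using \<open>finite U\<close> by (simp_all add: sum.delta)
  qed
  have V: "v1 \<in> V" "v2 \<in> V" "v3 \<in> V" "v4 \<in> V" and UV: "u \<in> U \<Longrightarrow> u \<in> V" for u
    by (auto simp: V_def)
  have VE: thesis if "x \<in> V" "x = v1 \<Longrightarrow> thesis" "x = v2 \<Longrightarrow> thesis" "x = v3 \<Longrightarrow> thesis"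
      "x = v4 \<Longrightarrow> thesis" "x \<in> U \<Longrightarrow> thesis" for x thesis
    using that by (auto simp: V_def)
  have UW_eq: "\<delta> u v2 = \<delta> u v1" "\<delta> u v4 = \<delta> u v3" "\<delta> v1 u = \<delta> u v1" "\<delta> v2 u = \<delta> u v1"
    "\<delta> v3 u = \<delta> u v3" "\<delta> v4 u = \<delta> u v3" "\<epsilon> u v1 = \<delta> u v1" "\<epsilon> u v2 = \<delta> u v1"
    "\<epsilon> u v3 = \<delta> u v3" "\<epsilon> u v4 = \<delta> u v3" "\<epsilon> v1 u = \<delta> u v1" "\<epsilon> v2 u = \<delta> u v1"
    "\<epsilon> v3 u = \<delta> u v3" "\<epsilon> v4 u = \<delta> u v3" if "u \<in> U" for u
    using that sym[OF V(1) UV] sym[OF V(2) UV] sym[OF V(3) UV] sym[OF V(4) UV]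
    by (simp_all add: cousin off V)
  have W_sym: "\<delta> v2 v1 = \<delta> v1 v2" "\<delta> v3 v1 = \<delta> v1 v3" "\<delta> v4 v1 = \<delta> v1 v4"
    "\<delta> v3 v2 = \<delta> v2 v3" "\<delta> v4 v2 = \<delta> v2 v4" "\<delta> v4 v3 = \<delta> v3 v4"
    "\<epsilon> v2 v1 = \<epsilon> v1 v2" "\<epsilon> v3 v1 = \<epsilon> v1 v3" "\<epsilon> v4 v1 = \<epsilon> v1 v4"
    "\<epsilon> v3 v2 = \<epsilon> v2 v3" "\<epsilon> v4 v2 = \<epsilon> v2 v4" "\<epsilon> v4 v3 = \<epsilon> v3 v4"
    by (rule sym; simp add: V)+
  define s where "s = (\<Sum>u\<in>U. \<delta> u v1)"
  \<comment> \<open>All four cousins have the same outside sum: within a pair by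
    \<open>cousin\<close>, between the pairs by \<open>sums\<close>.\<close>
  have sumU: "(\<Sum>u\<in>U. \<delta> x u) = s" "(\<Sum>u\<in>U. \<epsilon> x u) = s" if "x \<in> {v1, v2, v3, v4}" for x
    using that sums by (auto simp: s_def UW_eq cong: sum.cong)
  have lapW: "weighted_laplacian V \<delta> x x = \<delta> x v1 + \<delta> x v2 + \<delta> x v3 + \<delta> x v4 + s"
    "weighted_laplacian V \<epsilon> x x = \<epsilon> x v1 + \<epsilon> x v2 + \<epsilon> x v3 + \<epsilon> x v4 + s" if "x \<in> {v1, v2, v3, v4}" for x
    using that diag V by (auto simp: weighted_laplacian_def sumV sumU)
  have lap_off: "weighted_laplacian V \<gamma> x y = - \<gamma> x y" if "x \<noteq> y" for \<gamma> :: "'a \<Rightarrow> 'a \<Rightarrow> real" and x y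
    using that by (simp add: weighted_laplacian_def)
  have lapU: "weighted_laplacian V \<epsilon> u x = weighted_laplacian V \<delta> u x"
    "weighted_laplacian V \<epsilon> x u = weighted_laplacian V \<delta> x u" if "u \<in> U" "x \<in> V" for u x
  proof -
    have "sum (\<epsilon> u) V = sum (\<delta> u) V" using that by (intro sum.cong) (auto simp: off)
    moreover have "\<epsilon> x u = \<delta> x u"
      using off[of u x] sym[of x u] that UV by simp
    ultimately show "weighted_laplacian V \<epsilon> u x = weighted_laplacian V \<delta> u x"
      "weighted_laplacian V \<epsilon> x u = weighted_laplacian V \<delta> x u"
      using that by (auto simp: weighted_laplacian_def off)
  qed
  have Q_Q: "(\<Sum>y\<in>V. Q x y * Q y z) = of_bool (x = z)" if "x \<in> V" "z \<in> V" for x z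
    using that unfolding sumV right
    by (elim VE) (simp_all add: QU QW UW ne notin)
  \<comment> \<open>Each index is one of the four cousins or lies in \<open>U\<close>; every case
    reduces to a linear identity in \<delta> and \<open>s\<close>.\<close>
  have intertwine: "(\<Sum>y\<in>V. weighted_laplacian V \<delta> x y * Q y z) = (\<Sum>y\<in>V. Q x y * weighted_laplacian V \<epsilon> y z)"
    if "x \<in> V" "z \<in> V" for x z
    using that unfolding sumV left right
    by (elim VE)
      (simp_all add: QU QW UW ne notin lapU lapW lap_off V UV UW_eq diag W_sym swap
        field_simps)
  show ?thesis
  proof (rule similar_mat_reindex[OF ws us intertwine])
    show "(\<Sum>y\<in>V. Q x y * Q z y) = of_bool (x = z)" if "x \<in> V" "z \<in> V" for x z
      using Q_Q[OF that] by (simp add: Q_sym[of z])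
    show "(\<Sum>y\<in>V. Q y x * Q y z) = of_bool (x = z)" if "x \<in> V" "z \<in> V" for x z
      using Q_Q[OF that] by (simp add: Q_sym[of _ x])
  qed
qed

section \<open>Cousins\<close>

text \<open>For symmetric arcs the invariant is the absence of isolated vertices. It is all that is
  extracted below from the isomorphism of the induced subgraphs.\<close>

lemma digraph_iso_all_tails:
  assumes "digraph_iso K H"
  shows "(\<forall>x\<in>verts K. \<exists>e\<in>arcs K. tail K e = x) \<longleftrightarrow> (\<forall>y\<in>verts H. \<exists>e\<in>arcs H. tail H e = y)"
proof -
  obtain f where f: "pre_digraph.digraph_isomorphism K f" and H: "H = app_iso f K"
    using assms by (auto simp: digraph_iso_def)
  then have wf: "wf_digraph K" and inj: "inj_on (iso_verts f) (verts K)"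
    and tl: "\<And>e. e \<in> arcs K \<Longrightarrow> iso_verts f (tail K e) = iso_tail f (iso_arcs f e)"
    by (auto simp: pre_digraph.digraph_isomorphism_def)
  have "(\<exists>e\<in>arcs H. tail H e = iso_verts f x) \<longleftrightarrow> (\<exists>e\<in>arcs K. tail K e = x)" if "x \<in> verts K" for x
    using that tl inj_onD[OF inj] wf_digraph.tail_in_verts[OF wf] by (fastforce simp: H)
  then show ?thesis by (auto simp: H)
qed

lemma cousins_swaps:
  assumes "cousins G v1 v2 v3 v4"
  shows "cousins G v3 v4 v1 v2" "cousins G v1 v2 v4 v3" "cousins G v2 v1 v4 v3"
proof -
  have W: "{v3, v4, v1, v2} = {v1, v2, v3, v4}" "{v1, v2, v4, v3} = {v1, v2, v3, v4}"
    "{v2, v1, v4, v3} = {v1, v2, v3, v4}" by auto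
  let ?U = "pverts G - {v1, v2, v3, v4}"
  \<comment> \<open>\<open>cousins\<close> compares the sums only for the representatives
    \<open>v1\<close> and \<open>v3\<close>; the exchanges within a pair require those for
    \<open>v2\<close> and \<open>v4\<close>.\<close>
  have "(\<Sum>u\<in>?U. gdist G u v2) = (\<Sum>u\<in>?U. gdist G u v1)"
    "(\<Sum>u\<in>?U. gdist G u v4) = (\<Sum>u\<in>?U. gdist G u v3)"
    using assms by (auto simp: cousins_def Let_def intro!: sum.cong)
  then show "cousins G v3 v4 v1 v2" "cousins G v1 v2 v4 v3" "cousins G v2 v1 v4 v3"
    using assms unfolding cousins_def Let_def W by auto
qed

section \<open>Distances between cousins\<close>

context connected_pair_graph
begin

context
  fixes v1 v2 v3 v4 :: 'a
  assumes cousins: "cousins G v1 v2 v3 v4"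
begin

lemma cousin_verts:
  "v1 \<in> pverts G" "v2 \<in> pverts G" "v3 \<in> pverts G" "v4 \<in> pverts G"
  using cousins by (auto simp: cousins_def)

lemma cousin_distinct: "distinct [v1, v2, v3, v4]"
  using cousins by (auto simp: cousins_def)

lemma cousin_gdist:
  assumes "u \<in> pverts G - {v1, v2, v3, v4}"
  shows "d u v2 = d u v1" "d u v4 = d u v3"
  using cousins assms by (auto simp: cousins_def Let_def)

text \<open>
  If \<open>v3\<close> had no neighbour outside the cousins, every shortest path from \<open>v3\<close> to the outside
  would start with a step to \<open>v1\<close> or \<open>v2\<close>, making all distances from \<open>v3\<close> larger than those
  from \<open>v1\<close> and contradicting the equality of the two distance sums.
\<close>

lemma cousins_common_neighbour:
  assumes nonadj: "(v3, v4) \<notin> parcs G"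
  obtains u where "u \<in> pverts G - {v1, v2, v3, v4}" "(u, v3) \<in> parcs G" "(u, v4) \<in> parcs G"
proof -
  let ?U = "pverts G - {v1, v2, v3, v4}"
  have "\<exists>u\<in>?U. (v3, u) \<in> parcs G"
  proof (rule ccontr)
    assume none: "\<not> (\<exists>u\<in>?U. (v3, u) \<in> parcs G)"
    have "d u v1 < d u v3" if u: "u \<in> ?U" for u
    proof -
      obtain x where x: "(v3, x) \<in> parcs G" "x \<in> pverts G" "d v3 u = Suc (d x u)"
        using gdist_step[of v3 u] cousin_verts u by auto
      then have "x = v1 \<or> x = v2" using none nonadj no_loops' by blast
      then have "d x u = d u v1" using gdist_sym[of x u] x cousin_gdist u by auto
      then show ?thesis using x gdist_sym[of v3 u] cousin_verts u by simp
    qed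
    \<comment> \<open>The order being at least five enters here: the pointwise strict inequality
      yields a strict one for the sums only over a nonempty set.\<close>
    moreover have "?U \<noteq> {}"
    proof
      assume "?U = {}"
      then have "card (pverts G) \<le> card {v1, v2, v3, v4}" by (intro card_mono) auto
      also have "\<dots> \<le> 4" by (simp add: card_insert_if)
      finally show False using cousins by (simp add: cousins_def)
    qed
    ultimately have "(\<Sum>u\<in>?U. d u v1) < (\<Sum>u\<in>?U. d u v3)"
      using pair_finite_verts by (intro sum_strict_mono) auto
    then show False using cousins by (simp add: cousins_def Let_def)
  qed
  then obtain u where u: "u \<in> ?U" "(u, v3) \<in> parcs G" using arcs_symmetric by blast
  then have "d u v3 = 1" using gdist_eq_1_iff cousin_verts by auto
  then have "(u, v4) \<in> parcs G" using cousin_gdist[of u] u gdist_eq_1_iff cousin_verts by auto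
  with u that show ?thesis by blast
qed

lemma cousins_gdist_eq_2:
  assumes nonadj: "(v3, v4) \<notin> parcs G"
  shows "d v3 v4 = 2"
proof -
  obtain u where u: "u \<in> pverts G - {v1, v2, v3, v4}" "(u, v3) \<in> parcs G" "(u, v4) \<in> parcs G"
    by (rule cousins_common_neighbour[OF nonadj])
  then have "d v3 u = 1" "d u v4 = 1"
    using gdist_eq_1_iff cousin_verts arcs_symmetric by auto
  then have "d v3 v4 \<le> 2" using gdist_triangle[of v3 u v4] u cousin_verts by simp
  moreover have "d v3 v4 \<noteq> 0" "d v3 v4 \<noteq> 1"
    using gdist_eq_0_iff[of v3 v4] gdist_eq_1_iff[of v3 v4] cousin_verts cousin_distinct nonadj by auto
  ultimately show ?thesis by linarith
qed

text \<open>Let \<open>x\<close> be the first step of a shortest path from \<open>v1\<close> to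
  \<open>v4\<close>. An outside \<open>x\<close> is also adjacent to \<open>v2\<close> and
  equidistant from \<open>v3\<close> and \<open>v4\<close>, so the path can be mirrored. The
  assumption \<open>cross\<close> settles the case of adjacent \<open>v1\<close> and
  \<open>v4\<close>.\<close>

lemma cousins_cross_gdist_le:
  assumes nonadj: "(v1, v2) \<notin> parcs G" "(v3, v4) \<notin> parcs G"
    and cross: "(v1, v4) \<in> parcs G \<longleftrightarrow> (v2, v3) \<in> parcs G"
  shows "d v2 v3 \<le> d v1 v4"
proof (cases "(v1, v4) \<in> parcs G")
  case True
  with cross have "d v1 v4 = 1" "d v2 v3 = 1"
    using gdist_eq_1_iff[of v1 v4] gdist_eq_1_iff[of v2 v3] cousin_verts by auto
  then show ?thesis by simp
next
  case False
  have "v1 \<noteq> v4" using cousin_distinct by auto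
  then obtain x where x: "(v1, x) \<in> parcs G" "x \<in> pverts G" "d v1 v4 = Suc (d x v4)"
    using gdist_step[of v1 v4] cousin_verts by blast
  then have "x \<notin> {v1, v2, v4}" using nonadj False no_loops' by auto
  have x1: "d v1 x = 1" "d x v1 = 1"
    using x gdist_eq_1_iff[of v1 x] gdist_sym[of v1 x] cousin_verts by auto
  show ?thesis
  proof (cases "x = v3")
    case True
    \<comment> \<open>Now \<open>d v1 v4\<close> is 3. The vertex \<open>u\<close> is within 2 of
      \<open>v1\<close>, hence of \<open>v2\<close>, so going through \<open>u\<close> gives
      \<open>d v2 v3\<close> at most 3.\<close>
    obtain u where u: "u \<in> pverts G - {v1, v2, v3, v4}" "(u, v3) \<in> parcs G"
      using cousins_common_neighbour[OF nonadj(2)] by blast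
    then have "d u v3 = 1" "d v2 u = d u v1"
      using gdist_eq_1_iff gdist_sym[of v2 u] cousin_verts cousin_gdist by auto
    moreover have "d v2 v3 \<le> d v2 u + d u v3" "d u v1 \<le> d u v3 + d v3 v1"
      using gdist_triangle cousin_verts u by auto
    ultimately show ?thesis using True x x1 cousins_gdist_eq_2[OF nonadj(2)] by simp
  next
    case False
    with x \<open>x \<notin> {v1, v2, v4}\<close> have xU: "x \<in> pverts G - {v1, v2, v3, v4}" by auto
    then have "d v2 x = 1" "d x v3 = d x v4"
      using x1 gdist_sym[of v2 x] cousin_verts cousin_gdist[of x] by auto
    moreover have "d v2 v3 \<le> d v2 x + d x v3" using gdist_triangle cousin_verts x by auto
    ultimately show ?thesis using x by simp
  qed
qed

end

text \<open>The permutation preserves the pairs \<open>v1\<close>, \<open>v3\<close> and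
  \<open>v2\<close>, \<open>v4\<close> and exchanges the pairs \<open>v1\<close>, \<open>v4\<close>
  and \<open>v2\<close>, \<open>v3\<close>. So among the cross distances in \<open>G\<close> only
  the last two have to agree, and \<open>cross\<close> ensures this.\<close>

lemma cousins_mat_spectrum_eq:
  assumes cousins: "cousins G v1 v2 v3 v4"
    and nonadj: "(v1, v2) \<notin> parcs G" "(v3, v4) \<notin> parcs G"
    and cross: "(v1, v4) \<in> parcs G \<longleftrightarrow> (v2, v3) \<in> parcs G"
    and ws: "vertex_enum (add_edge G v1 v2) ws" and us: "vertex_enum (add_edge G v3 v4) us"
  shows "mat_spectrum (distance_laplacian (add_edge G v1 v2) ws) =
    mat_spectrum (distance_laplacian (add_edge G v3 v4) us)"
proof -
  note V = cousin_verts[OF cousins] and dist = cousin_distinct[OF cousins]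
  define U where "U = pverts G - {v1, v2, v3, v4}"
  have VU: "pverts G = {v1, v2, v3, v4} \<union> U" using V by (auto simp: U_def)
  let ?d1 = "\<lambda>x y. real (gdist (add_edge G v1 v2) x y)"
  let ?d2 = "\<lambda>x y. real (gdist (add_edge G v3 v4) x y)"
  note add = gdist_add_edge[OF V(1,2)] gdist_add_edge[OF V(3,4)]
  have d34: "d v3 v4 = 2" and d12: "d v1 v2 = 2"
    using cousins_gdist_eq_2 cousins_swaps[OF cousins] cousins nonadj by blast+
  have sym: "d x y = d y x" if "x \<in> pverts G" "y \<in> pverts G" for x y
    by (rule gdist_sym[OF that])
  have W_sym: "d v2 v1 = d v1 v2" "d v3 v1 = d v1 v3" "d v4 v1 = d v1 v4"
    "d v3 v2 = d v2 v3" "d v4 v2 = d v2 v4" "d v4 v3 = d v3 v4"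
    by (rule sym; simp add: V)+
  have "d v2 v3 \<le> d v1 v4" using cousins_cross_gdist_le[OF cousins nonadj cross] .
  moreover have "d v1 v4 \<le> d v2 v3"
    by (rule cousins_cross_gdist_le[OF cousins_swaps(3)[OF cousins]])
      (use nonadj cross in \<open>auto dest: arcs_symmetric\<close>)
  ultimately have d23: "d v2 v3 = d v1 v4" by simp
  \<comment> \<open>With positive cross distances, a detour between the members of one pair over the
    edge joining the other has length at least 3, so their distance stays 2.\<close>
  have pos: "d v1 v3 \<noteq> 0" "d v1 v4 \<noteq> 0" "d v2 v4 \<noteq> 0"
    using dist by (auto simp: gdist_eq_0_iff V)
  have refl: "d x x = 0" if "x \<in> pverts G" for x by (rule gdist_refl[OF that])
  have U1: "gdist (add_edge G v1 v2) u x = d u x" "gdist (add_edge G v3 v4) u x = d u x"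
    if "u \<in> U" "x \<in> pverts G" for u x
  proof -
    have u: "u \<in> pverts G" "d u v2 = d u v1" "d u v4 = d u v3"
      using that cousin_gdist[OF cousins] by (auto simp: U_def)
    \<comment> \<open>The ends of the new edge are equidistant from \<open>u\<close>, so crossing it
      is never shorter than going straight to its far end.\<close>
    have "d u x \<le> d u v + d v x" if "v \<in> pverts G" for v
      using gdist_triangle u \<open>x \<in> pverts G\<close> that by blast
    from this[OF V(1)] this[OF V(2)] this[OF V(3)] this[OF V(4)]
    show "gdist (add_edge G v1 v2) u x = d u x" "gdist (add_edge G v3 v4) u x = d u x"
      using u that by (simp_all add: add)
  qed
  have "finite U" using pair_finite_verts by (simp add: U_def)
  have enum: "set ws = pverts G" "distinct ws" "set us = pverts G" "distinct us"
    using ws us by (auto simp: vertex_enum_def add_edge_def)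
  have "similar_mat
    (mat (length ws) (length ws) (\<lambda>(i, j). weighted_laplacian (pverts G) ?d1 (ws ! i) (ws ! j)))
    (mat (length us) (length us) (\<lambda>(i, j). weighted_laplacian (pverts G) ?d2 (us ! i) (us ! j)))"
  proof (rule similar_mat_weighted_laplacian_cousin_swap[of U v1 v2 v3 v4 ?d1 ?d2, folded VU])
    show "distinct ws" "set ws = pverts G" "distinct us" "set us = pverts G" by (fact enum)+
    show "finite U" "distinct [v1, v2, v3, v4]" "v1 \<notin> U" "v2 \<notin> U" "v3 \<notin> U" "v4 \<notin> U"
      using \<open>finite U\<close> dist by (auto simp: U_def)
    show "?d1 x y = ?d1 y x" "?d2 x y = ?d2 y x" if "x \<in> pverts G" "y \<in> pverts G" for x y
      using that sym[OF that] sym[OF that(1) V(1)] sym[OF that(1) V(2)] sym[OF that(1) V(3)]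
        sym[OF that(1) V(4)] sym[OF that(2) V(1)] sym[OF that(2) V(2)] sym[OF that(2) V(3)]
        sym[OF that(2) V(4)] by (simp_all add: add V min.commute add.commute)
    show "?d1 x x = 0" "?d2 x x = 0" if "x \<in> pverts G" for x
      using that by (simp_all add: add refl)
    show "?d2 u x = ?d1 u x" if "u \<in> U" "x \<in> pverts G" for u x
      using U1 that by simp
    show "?d1 u v2 = ?d1 u v1" "?d1 u v4 = ?d1 u v3" if "u \<in> U" for u
      using U1[OF that] V cousin_gdist[OF cousins] that by (auto simp: U_def)
    have "(\<Sum>u\<in>U. d u v1) = (\<Sum>u\<in>U. d u v3)"
      using cousins unfolding cousins_def Let_def U_def by blast
    then have "(\<Sum>u\<in>U. real (d u v1)) = (\<Sum>u\<in>U. real (d u v3))"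
      by (simp flip: of_nat_sum)
    then show "(\<Sum>u\<in>U. ?d1 u v1) = (\<Sum>u\<in>U. ?d1 u v3)" using U1 V by simp
  qed (use pos in \<open>simp_all add: add V refl W_sym d12 d34 d23\<close>)
  then have "similar_mat (distance_laplacian (add_edge G v1 v2) ws) (distance_laplacian (add_edge G v3 v4) us)"
    using enum by (simp add: distance_laplacian_eq_weighted_laplacian add_edge_def)
  then show ?thesis by (rule mat_spectrum_similar)
qed

text \<open>If both equivalences fail, there are exactly two cross edges and they share a vertex.
  One added edge then completes a star on the four cousins, the other a triangle with an isolated
  vertex, and \<open>digraph_iso_all_tails\<close> tells these apart.\<close>

lemma induced_iso_cross_arcs:
  assumes dist: "distinct [v1, v2, v3, v4]"
    and nonadj: "(v1, v2) \<notin> parcs G" "(v3, v4) \<notin> parcs G"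
    and iso: "digraph_iso (with_proj (add_edge G v1 v2) \<restriction> {v1, v2, v3, v4})
      (with_proj (add_edge G v3 v4) \<restriction> {v1, v2, v3, v4})"
  shows "((v1, v4) \<in> parcs G \<longleftrightarrow> (v2, v3) \<in> parcs G) \<or> ((v1, v3) \<in> parcs G \<longleftrightarrow> (v2, v4) \<in> parcs G)"
proof -
  have covered: "(\<forall>x\<in>verts (with_proj H \<restriction> W). \<exists>e\<in>arcs (with_proj H \<restriction> W). tail (with_proj H \<restriction> W) e = x)
      \<longleftrightarrow> (\<forall>x\<in>W. \<exists>y\<in>W. (x, y) \<in> parcs H)" for H :: "'a pair_pre_digraph" and W
    by fastforce
  have sym: "(x, y) \<in> parcs G \<longleftrightarrow> (y, x) \<in> parcs G" for x y using arcs_symmetric by blast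
  have "(v1, v1) \<notin> parcs G" "(v2, v2) \<notin> parcs G" "(v3, v3) \<notin> parcs G" "(v4, v4) \<notin> parcs G"
    using no_loops' by blast+
  with digraph_iso_all_tails[OF iso] nonadj dist show ?thesis
    unfolding covered
    by (auto simp: add_edge_def sym[of v2 v1] sym[of v3 v1] sym[of v4 v1] sym[of v3 v2] sym[of v4 v2] sym[of v4 v3])
qed

end

theorem theorem3p9:
  fixes G G1 G2 :: "'a pair_pre_digraph" and v1 v2 v3 v4 :: 'a
  assumes "pair_graph G" and "connected (with_proj G)"
    and "cousins G v1 v2 v3 v4"
    and "(v1, v2) \<notin> parcs G" and "(v3, v4) \<notin> parcs G"
    and "G1 = add_edge G v1 v2" and "G2 = add_edge G v3 v4"
    and "digraph_iso (with_proj G1 \<restriction> {v1, v2, v3, v4}) (with_proj G2 \<restriction> {v1, v2, v3, v4})"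
    and "\<not> digraph_iso (with_proj G1) (with_proj G2)"
  shows "DL_cospectral G1 G2"
proof -
  interpret connected_pair_graph G
    using assms(1,2) by (intro connected_pair_graph.intro connected_pair_graph_axioms.intro)
  have comm: "add_edge G v4 v3 = add_edge G v3 v4" by (simp add: add_edge_def insert_commute)
  have nonadj': "(v4, v3) \<notin> parcs G" using assms(5) arcs_symmetric by blast
  have dist: "distinct [v1, v2, v3, v4]" using assms(3) by (simp add: cousins_def)
  \<comment> \<open>The second alternative is the first with \<open>v3\<close> and \<open>v4\<close>
    exchanged, which changes neither the cousins nor \<open>G2\<close>.\<close>
  consider "(v1, v4) \<in> parcs G \<longleftrightarrow> (v2, v3) \<in> parcs G" | "(v1, v3) \<in> parcs G \<longleftrightarrow> (v2, v4) \<in> parcs G"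
    using induced_iso_cross_arcs[OF dist assms(4,5)] assms(6-8) by blast
  then have "mat_spectrum (distance_laplacian G1 ws) = mat_spectrum (distance_laplacian G2 us)"
    if "vertex_enum G1 ws" "vertex_enum G2 us" for ws us
  proof cases
    case 1
    then show ?thesis using cousins_mat_spectrum_eq[OF assms(3-5)] that assms(6,7) by simp
  next
    case 2
    then show ?thesis
      using cousins_mat_spectrum_eq[OF cousins_swaps(2)[OF assms(3)] assms(4) nonadj'] that assms(6,7)
      by (simp add: comm)
  qed
  with assms(9) show ?thesis by (simp add: DL_cospectral_def)
qed

end
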